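(* Let $\mathcal{L} \subseteq \mathbb{S}^n$ be a linear subspace and $C, Y \in \mathbb{S}^n$. Let $C_{\mathcal{L}}$ be the orthogonal projection of $C$ onto $\mathcal{L}$ and $Y_{\mathcal{L}^{\perp}}$ the orthogonal projection of $Y$ onto $\mathcal{L}^{\perp}$. The optimal admissible subspace $\mathcal{S}_{opt}$ is the output of the following algorithm: initialize $\mathcal{S} \leftarrow \mathrm{span}\{C_{\mathcal{L}}, Y_{\mathcal{L}^{\perp}}\}$, and then repeat the two successive updates $$\mathcal{S} \leftarrow \mathcal{S} + P_{\mathcal{L}}(\mathcal{S}), \qquad \mathcal{S} \leftarrow \mathcal{S} + \mathrm{span}\{X^2 : X \in \mathcal{S}\}$$ until the resulting ascending chain of subspaces stabilizes; output the subspace $\mathcal{S}$ at which the chain stabilizes. (That is, the chain stabilizes after finitely many iterations, and its stable value equals $\mathcal{S}_{opt}$.)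
   Context: $\mathbb{S}^n$ is the space of real symmetric $n\times n$ matrices with the trace inner product $X\cdot Y := \mathrm{Tr}(XY)$ and Jordan product $X\circ Y := \frac12(XY+YX)$; $\mathbb{S}^n_+$ is the positive semidefinite cone; $P_{\mathcal{S}}$ denotes orthogonal projection onto a subspace $\mathcal{S}$. The data $C, Y, \mathcal{L}$ define the primal-dual pair of semidefinite programs: minimize $C\cdot X$ subject to $X \in (Y+\mathcal{L})\cap \mathbb{S}^n_+$; and maximize $-Y\cdot S$ subject to $S\in (C+\mathcal{L}^\perp)\cap\mathbb{S}^n_+$. Definition. A subspace $\mathcal{S} \subseteq \mathbb{S}^n$ is admissible if $P_{\mathcal{S}}$ satisfies all of: (a) $P_{\mathcal{S}}(\mathbb{S}^n_+)\subseteq \mathbb{S}^n_+$; (b) $P_{\mathcal{S}}(Y+\mathcal{L})\subseteq Y+\mathcal{L}$; (c) $P_{\mathcal{S}}(C+\mathcal{L}^\perp)\subseteq C+\mathcal{L}^\perp$; (d) (unitality) there exists $E\in\mathcal{S}$ with $X\circ E = X$ for all $X\in\mathcal{S}$. Definition. $\mathcal{S}_{opt}$ is the intersection of all admissible subspaces. *)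

theory Defs
  imports
    "HOL-Analysis.Analysis"
    "HOL-Library.Set_Algebras"
    "HOL-Library.While_Combinator"
begin

definition Sym :: "(real^'n^'n) set" where
  "Sym = {X. transpose X = X}"

definition PSD :: "(real^'n^'n) set" where
  "PSD = {X \<in> Sym. \<forall>v. 0 \<le> v \<bullet> (X *v v)}"

text \<open>On \<^term>\<open>Sym\<close> this agrees with the componentwise inner product of the library
  (lemma \<open>trace_inner_eq_inner\<close> below); on non-symmetric matrices it does not.\<close>

definition trace_inner :: "real^'n^'n \<Rightarrow> real^'n^'n \<Rightarrow> real" where
  "trace_inner X Y = trace (X ** Y)"

definition jordan_prod :: "real^'n^'n \<Rightarrow> real^'n^'n \<Rightarrow> real^'n^'n" where
  "jordan_prod X Y = (1/2) *\<^sub>R (X ** Y + Y ** X)"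

text \<open>The complement is taken inside the space of symmetric matrices.\<close>

definition perp :: "(real^'n^'n) set \<Rightarrow> (real^'n^'n) set" where
  "perp L = {X \<in> Sym. \<forall>Z\<in>L. trace_inner X Z = 0}"

text \<open>Only meaningful for a subspace \<open>S \<subseteq> Sym\<close> and \<open>X \<in> Sym\<close>; for these the description is
  well-defined by lemma \<open>orth_proj_ex1\<close>.\<close>

definition orth_proj :: "(real^'n^'n) set \<Rightarrow> real^'n^'n \<Rightarrow> real^'n^'n" where
  "orth_proj S X = (THE Z. Z \<in> S \<and> (\<forall>W\<in>S. trace_inner (X - Z) W = 0))"

definition admissible ::
  "(real^'n^'n) set \<Rightarrow> real^'n^'n \<Rightarrow> real^'n^'n \<Rightarrow> (real^'n^'n) set \<Rightarrow> bool" where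
  "admissible L C Y S \<longleftrightarrow>
     subspace S \<and> S \<subseteq> Sym \<and>
     orth_proj S ` PSD \<subseteq> PSD \<and>
     orth_proj S ` ((+) Y ` L) \<subseteq> (+) Y ` L \<and>
     orth_proj S ` ((+) C ` perp L) \<subseteq> (+) C ` perp L \<and>
     (\<exists>E\<in>S. \<forall>X\<in>S. jordan_prod X E = X)"

definition S_opt ::
  "(real^'n^'n) set \<Rightarrow> real^'n^'n \<Rightarrow> real^'n^'n \<Rightarrow> (real^'n^'n) set" where
  "S_opt L C Y = \<Inter> {S. admissible L C Y S}"

definition alg_init ::
  "(real^'n^'n) set \<Rightarrow> real^'n^'n \<Rightarrow> real^'n^'n \<Rightarrow> (real^'n^'n) set" where
  "alg_init L C Y = span {orth_proj L C, orth_proj (perp L) Y}"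

text \<open>In the two updates, \<open>+\<close> is the Minkowski sum of sets. Stabilization is tested
  after a complete round: the first half-update alone always fixes the initial subspace.\<close>

definition proj_update :: "(real^'n^'n) set \<Rightarrow> (real^'n^'n) set \<Rightarrow> (real^'n^'n) set" where
  "proj_update L S = S + orth_proj L ` S"

definition square_update :: "(real^'n^'n) set \<Rightarrow> (real^'n^'n) set" where
  "square_update S = S + span {X ** X | X. X \<in> S}"

definition alg_round :: "(real^'n^'n) set \<Rightarrow> (real^'n^'n) set \<Rightarrow> (real^'n^'n) set" where
  "alg_round L S = square_update (proj_update L S)"

lemma trace_inner_eq_inner:
  fixes X Y :: "real^'n^'n"
  assumes "Y \<in> Sym"
  shows "trace_inner X Y = X \<bullet> Y"
proof -
  have "Y $ j $ i = Y $ i $ j" for i j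
    using assms by (metis (mono_tags, lifting) Sym_def mem_Collect_eq transpose_def vec_lambda_beta)
  then show ?thesis
    by (simp add: trace_inner_def trace_def matrix_matrix_mult_def inner_vec_def)
qed

lemma orth_proj_ex1:
  fixes S :: "(real^'n^'n) set"
  assumes "subspace S" "S \<subseteq> Sym"
  shows "\<exists>!Z. Z \<in> S \<and> (\<forall>W\<in>S. trace_inner (X - Z) W = 0)"
proof -
  have tr: "trace_inner A W = A \<bullet> W" if "W \<in> S" for A W
    using that assms(2) by (auto intro: trace_inner_eq_inner)
  obtain y z where yz: "y \<in> span S" "\<And>w. w \<in> span S \<Longrightarrow> orthogonal z w" "X = y + z"
    by (rule orthogonal_subspace_decomp_exists[of S X]) blast
  have sp: "span S = S"
    using assms(1) by (simp add: span_eq_iff)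
  show ?thesis
  proof (rule ex1I[of _ y])
    show "y \<in> S \<and> (\<forall>W\<in>S. trace_inner (X - y) W = 0)"
      using yz sp by (auto simp: tr orthogonal_def)
  next
    fix Z assume Z: "Z \<in> S \<and> (\<forall>W\<in>S. trace_inner (X - Z) W = 0)"
    have d: "y - Z \<in> S"
      using yz(1) Z assms(1) by (simp add: sp subspace_diff)
    have "(X - Z) \<bullet> (y - Z) = 0" "z \<bullet> (y - Z) = 0"
      using Z d tr yz(2) sp by (auto simp: orthogonal_def)
    then have "(y - Z) \<bullet> (y - Z) = 0"
      using yz(3) by (simp add: algebra_simps inner_add_left inner_diff_left)
    then show "Z = y" by simp
  qed
qed

end

theory Submission
  imports Defs
begin

text \<open>A subspace \<open>S\<close> is admissible iff it contains the two generators, is invariant under the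
  projection onto \<open>L\<close> and is closed under squares; the algorithm computes the least such subspace.
  The affine conditions (b) and (c) say that the orthogonal projections onto \<open>S\<close> and \<open>L\<close> commute
  and that \<open>S\<close> contains the generators. If the projection onto \<open>S\<close> is positive and unital, then
  Kadison's inequality and preservation of the trace force \<open>S\<close> to be closed under squares.
  Conversely, if \<open>S\<close> is closed under squares, it is closed under the functional calculus for
  functions vanishing at 0; this yields a unit, and testing the projection of a positive semidefinite
  matrix against the square of its own negative part shows that this part vanishes.\<close>

section \<open>Spectral theorem for self-adjoint maps\<close>

text \<open>Maximize the Rayleigh quotient on the unit sphere of \<open>V\<close>. The form
  \<open>q v = m * (v \<bullet> v) - v \<bullet> f v\<close> is nonnegative on \<open>V\<close> and
  vanishes at a maximizer \<open>u\<close>, so half its gradient there,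
  \<open>w = m u - f u\<close>, must be 0.\<close>

lemma selfadjoint_eigenvector:
  fixes f :: "'a::euclidean_space \<Rightarrow> 'a"
  assumes "linear f" and sa: "\<And>v w. f v \<bullet> w = v \<bullet> f w"
    and V: "subspace V" "f ` V \<subseteq> V" "V \<noteq> {0}"
  obtains u m where "u \<in> V" "norm u = 1" "f u = m *\<^sub>R u"
proof -
  interpret f: linear f by fact
  let ?K = "V \<inter> sphere 0 1"
  obtain x where "x \<in> V" "x \<noteq> 0"
    using V(1,3) subspace_0 by blast
  then have "x /\<^sub>R norm x \<in> ?K"
    using V(1) by (simp add: subspace_scale)
  then have ne: "?K \<noteq> {}"
    by blast
  have "compact ?K"
    using closed_subspace[OF V(1)] by (simp add: closed_Int_compact)
  moreover have "continuous_on ?K (\<lambda>v. v \<bullet> f v)"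
    by (intro continuous_intros linear_continuous_on linear_conv_bounded_linear[THEN iffD1] assms(1))
  ultimately obtain u where u: "u \<in> ?K" and max: "\<And>v. v \<in> ?K \<Longrightarrow> v \<bullet> f v \<le> u \<bullet> f u"
    using continuous_attains_sup[OF _ ne] by blast
  define m where "m = u \<bullet> f u"
  define q where "q v = m * (v \<bullet> v) - v \<bullet> f v" for v
  have q_nonneg: "q v \<ge> 0" if "v \<in> V" for v
  proof (cases "v = 0")
    case False
    then have "v /\<^sub>R norm v \<in> ?K"
      using V(1) that by (simp add: subspace_scale)
    from max[OF this] have "(v \<bullet> f v) / (norm v)\<^sup>2 \<le> m"
      by (simp add: m_def f.scale power2_eq_square divide_simps)
    then show ?thesis
      using False by (simp add: q_def divide_simps power2_norm_eq_inner)
  qed (simp add: q_def f.zero)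
  have uu: "u \<bullet> u = 1"
    using u by (simp add: norm_eq_1)
  define w where "w = m *\<^sub>R u - f u"
  have w: "w \<in> V"
    unfolding w_def using u V by (intro subspace_diff subspace_scale) auto
  \<comment> \<open>On the line through \<open>u\<close> in direction \<open>w\<close>,
    \<open>q\<close> is a quadratic in \<open>t\<close> without constant term; its nonnegativity for
    all \<open>t\<close> forces the linear coefficient to vanish.\<close>
  have quad: "0 \<le> t\<^sup>2 * q w + 2 * t * (w \<bullet> w)" for t
  proof -
    have "q (u + t *\<^sub>R w) = t\<^sup>2 * q w + 2 * t * (w \<bullet> w)"
    proof -
      have wu: "w \<bullet> u = 0"
        by (simp add: w_def inner_diff_left uu m_def inner_commute[of "f u"])
      have fuw: "f u \<bullet> w = - (w \<bullet> w)"
      proof -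
        have "f u = m *\<^sub>R u - w"
          by (simp add: w_def)
        then have "f u \<bullet> w = m * (u \<bullet> w) - w \<bullet> w"
          by (simp only: inner_diff_left inner_scaleR_left)
        then show ?thesis
          using wu by (simp add: inner_commute)
      qed
      have "u \<bullet> f w = - (w \<bullet> w)"
        using fuw by (simp only: sa)
      moreover have "w \<bullet> f u = - (w \<bullet> w)"
        using fuw by (simp only: inner_commute)
      ultimately show ?thesis
        using wu by (simp add: q_def f.add f.scale inner_add_left inner_add_right uu m_def[symmetric]
            inner_commute[of u w] algebra_simps power2_eq_square)
    qed
    then show ?thesis
      using q_nonneg[of "u + t *\<^sub>R w"] u w V(1) by (simp add: subspace_add subspace_scale)
  qed
  have "w \<bullet> w = 0"
  proof (rule ccontr)
    assume "w \<bullet> w \<noteq> 0"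
    then have pos: "w \<bullet> w > 0"
      by (simp add: dot_square_norm)
    define a where "a = q w"
    have "a \<ge> 0"
      using q_nonneg[OF w] by (simp add: a_def)
    \<comment> \<open>A negative \<open>t\<close> for which the linear term outweighs the quadratic
      one; \<open>a + 1\<close> keeps the denominator positive when \<open>a = 0\<close>.\<close>
    define t where "t = - (w \<bullet> w) / (a + 1)"
    have t: "w \<bullet> w = - t * (a + 1)"
      using \<open>a \<ge> 0\<close> by (simp add: t_def)
    have "t\<^sup>2 * a + 2 * t * (w \<bullet> w) = - (t\<^sup>2 * (a + 2))"
      unfolding t by (simp add: algebra_simps power2_eq_square)
    also have "\<dots> < 0"
      using pos t \<open>a \<ge> 0\<close> by (cases "t = 0") auto
    finally show False
      using quad[of t, folded a_def] by linarith
  qed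
  then have "f u = m *\<^sub>R u"
    by (simp add: w_def)
  then show ?thesis
    using that u by auto
qed

text \<open>Split off a unit eigenvector \<open>u\<close>. By self-adjointness the vectors of
  \<open>V\<close> orthogonal to \<open>u\<close> again form an invariant subspace, of smaller
  dimension; stating the claim for invariant subspaces lets the induction apply to it.\<close>

lemma selfadjoint_eigenbasis:
  fixes f :: "'a::euclidean_space \<Rightarrow> 'a"
  assumes "linear f" and sa: "\<And>v w. f v \<bullet> w = v \<bullet> f w"
    and "subspace V" "f ` V \<subseteq> V"
  shows "\<exists>B l. pairwise orthogonal B \<and> (\<forall>b\<in>B. norm b = 1) \<and> span B = V \<and> (\<forall>b\<in>B. f b = l b *\<^sub>R b)"
  using assms(3,4)
proof (induction "dim V" arbitrary: V rule: less_induct)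
  case less
  note V = less.prems
  show ?case
  proof (cases "V = {0}")
    case True
    then show ?thesis
      by (intro exI[of _ "{}"]) auto
  next
    case False
    obtain u m where u: "u \<in> V" "norm u = 1" "f u = m *\<^sub>R u"
      using selfadjoint_eigenvector[OF assms(1) sa V False] by blast
    define W where "W = V \<inter> {v. u \<bullet> v = 0}"
    have W: "subspace W"
      unfolding W_def using V(1) subspace_hyperplane by (rule subspace_inter)
    have "f v \<in> W" if "v \<in> W" for v
    proof -
      have "u \<bullet> f v = 0"
        using that by (simp add: sa[symmetric] u W_def)
      then show ?thesis
        using that V(2) by (auto simp: W_def)
    qed
    then have inv: "f ` W \<subseteq> W"
      by blast
    have "u \<notin> W"
      using u(2) by (auto simp: W_def norm_eq_1)
    then have "W \<subset> V"
      using u(1) unfolding W_def by blast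
    then have "dim W < dim V"
      using V(1) W by (intro dim_psubset) (simp add: span_eq_iff[THEN iffD2])
    from less.hyps[OF this W inv] obtain B l where
      B: "pairwise orthogonal B" "\<forall>b\<in>B. norm b = 1" "span B = W" "\<forall>b\<in>B. f b = l b *\<^sub>R b"
      by blast
    have BW: "B \<subseteq> W"
      using B(3) span_superset by blast
    have "pairwise orthogonal (insert u B)"
      using B(1) BW by (auto simp: pairwise_insert orthogonal_def W_def inner_commute)
    moreover have "span (insert u B) = V"
    proof
      show "span (insert u B) \<subseteq> V"
        using BW u(1) V(1) by (intro span_minimal) (auto simp: W_def)
      show "V \<subseteq> span (insert u B)"
      proof
        fix v assume "v \<in> V"
        then have "v - (u \<bullet> v) *\<^sub>R u \<in> W"
          using u V(1) by (simp add: W_def subspace_diff subspace_scale inner_diff_right norm_eq_1)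
        then show "v \<in> span (insert u B)"
          using B(3) by (auto simp: span_insert)
      qed
    qed
    moreover have "\<forall>b\<in>insert u B. f b = (l(u := m)) b *\<^sub>R b"
      using u B(4) \<open>u \<notin> W\<close> BW by auto
    ultimately show ?thesis
      using B(2) u(2) by (intro exI[of _ "insert u B"] exI[of _ "l(u := m)"]) auto
  qed
qed

section \<open>Symmetric matrices and diagonalization in an orthonormal basis\<close>

lemma Sym_subspace: "subspace (Sym :: (real^'n^'n) set)"
  by (auto simp: subspace_def Sym_def transpose_def vec_eq_iff)

lemma Sym_inner:
  assumes "X \<in> Sym"
  shows "(X *v v) \<bullet> w = v \<bullet> (X *v w)"
proof -
  have "X *v v = v v* X"
    using assms transpose_matrix_vector[of X v] by (simp add: Sym_def)
  then show ?thesis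
    by (simp add: dot_lmul_matrix)
qed

definition outer :: "real^'n \<Rightarrow> real^'n^'n" where
  "outer b = (\<chi> i j. b $ i * b $ j)"

lemma outer_mult_vec: "outer b *v v = (b \<bullet> v) *\<^sub>R b"
  by (simp add: outer_def vec_eq_iff matrix_vector_mult_def inner_vec_def sum_distrib_left
      sum_distrib_right mult_ac)

lemma outer_PSD: "outer b \<in> PSD"
  by (auto simp: PSD_def Sym_def outer_mult_vec inner_commute)
     (simp add: outer_def transpose_def vec_eq_iff)

lemma inner_outer: "X \<bullet> outer b = b \<bullet> (X *v b)"
  by (simp add: outer_def inner_vec_def matrix_vector_mult_def sum_distrib_left mult_ac)

lemma matrix_add_rdistrib: "(A + B) ** C = A ** C + B ** (C :: real^'n^'m)"
  by (simp add: matrix_matrix_mult_def vec_eq_iff sum.distrib algebra_simps)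

lemma scaleR_matrix_mult: "(c *\<^sub>R A) ** B = c *\<^sub>R (A ** (B :: real^'n^'m))"
  by (simp add: matrix_matrix_mult_def vec_eq_iff sum_distrib_left mult.assoc)

lemma matrix_vector_mult_sum: "(\<Sum>b\<in>B. c b *\<^sub>R A b) *v v = (\<Sum>b\<in>B. c b *\<^sub>R (A b *v (v::real^'n)))"
  by (induction B rule: infinite_finite_induct)
     (auto simp: matrix_vector_mult_add_rdistrib scaleR_matrix_vector_assoc)

locale orthonormal_basis =
  fixes B :: "(real^'n) set"
  assumes orth: "pairwise orthogonal B" and norm1: "\<And>b. b \<in> B \<Longrightarrow> norm b = 1"
    and span_UNIV: "span B = UNIV"
begin

lemma finite_B: "finite B"
  using orth norm1 by (intro pairwise_orthogonal_imp_finite)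

lemma inner_basis: "a \<in> B \<Longrightarrow> b \<in> B \<Longrightarrow> a \<bullet> b = (if a = b then 1 else 0)"
  using orth norm1 by (auto simp: pairwise_def orthogonal_def norm_eq_1)

lemma matrix_eq_on_basis:
  fixes X Y :: "real^'n^'n"
  assumes "\<And>b. b \<in> B \<Longrightarrow> X *v b = Y *v b"
  shows "X = Y"
proof -
  have "X *v v = Y *v v" for v
    using linear_eq_on[of "(*v) X" "(*v) Y" v B] assms span_UNIV by simp
  then show ?thesis
    by (simp add: matrix_eq)
qed

text \<open>Matrices diagonal in the basis \<open>B\<close> are written as functions on
  \<open>B\<close>, so that their algebra becomes pointwise. Indexing by basis vectors instead of
  eigenvalues avoids any care about multiplicities.\<close>

definition spec_mat :: "(real^'n \<Rightarrow> real) \<Rightarrow> real^'n^'n" where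
  "spec_mat f = (\<Sum>b\<in>B. f b *\<^sub>R outer b)"

lemma spec_mat_basis: "b \<in> B \<Longrightarrow> spec_mat f *v b = f b *\<^sub>R b"
  by (simp add: spec_mat_def matrix_vector_mult_sum outer_mult_vec inner_basis finite_B if_distrib
      if_distribR sum.delta cong: if_cong)

lemma spec_matI: "(\<And>b. b \<in> B \<Longrightarrow> X *v b = f b *\<^sub>R b) \<Longrightarrow> X = spec_mat f"
  by (rule matrix_eq_on_basis) (simp add: spec_mat_basis)

lemma spec_mat_cong: "(\<And>b. b \<in> B \<Longrightarrow> f b = g b) \<Longrightarrow> spec_mat f = spec_mat g"
  by (simp add: spec_mat_def)

lemma spec_mat_mult: "spec_mat f ** spec_mat g = spec_mat (\<lambda>b. f b * g b)"
  by (rule spec_matI) (simp add: matrix_vector_mul_assoc[symmetric] spec_mat_basis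
      matrix_vector_mult_scaleR mult.commute)

lemma spec_mat_add: "spec_mat f + spec_mat g = spec_mat (\<lambda>b. f b + g b)"
  by (simp add: spec_mat_def sum.distrib scaleR_add_left)

lemma spec_mat_diff: "spec_mat f - spec_mat g = spec_mat (\<lambda>b. f b - g b)"
  by (simp add: spec_mat_def sum_subtractf scaleR_diff_left)

lemma spec_mat_scale: "c *\<^sub>R spec_mat f = spec_mat (\<lambda>b. c * f b)"
  by (simp add: spec_mat_def scaleR_sum_right)

lemma inner_spec_mat: "X \<bullet> spec_mat f = (\<Sum>b\<in>B. f b * (b \<bullet> (X *v b)))"
  by (simp add: spec_mat_def inner_sum_right inner_outer)

lemma spec_mat_PSD:
  assumes "\<And>b. b \<in> B \<Longrightarrow> f b \<ge> 0" shows "spec_mat f \<in> PSD"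
proof -
  have "spec_mat f \<in> Sym"
    unfolding spec_mat_def using outer_PSD Sym_subspace
    by (intro subspace_sum subspace_scale) (auto simp: PSD_def)
  moreover have "v \<bullet> (spec_mat f *v v) = (\<Sum>b\<in>B. f b * (b \<bullet> v)\<^sup>2)" for v
    by (simp add: spec_mat_def matrix_vector_mult_sum outer_mult_vec inner_sum_right
        inner_commute[of v] power2_eq_square mult.assoc)
  ultimately show ?thesis
    using assms by (simp add: PSD_def sum_nonneg)
qed

end

lemma spectral_decomposition:
  fixes X :: "real^'n^'n"
  assumes "X \<in> Sym"
  obtains B l where "orthonormal_basis B" "X = orthonormal_basis.spec_mat B l"
proof -
  obtain B l where
    B: "pairwise orthogonal B" "\<forall>b\<in>B. norm b = 1" "span B = UNIV" "\<forall>b\<in>B. X *v b = l b *\<^sub>R b"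
    using selfadjoint_eigenbasis[of "(*v) X" UNIV] Sym_inner[OF assms] by auto
  then interpret orthonormal_basis B
    by unfold_locales auto
  have "X = spec_mat l"
    using B(4) by (intro spec_matI) auto
  then show ?thesis
    using that orthonormal_basis_axioms by blast
qed

section \<open>Positive semidefinite matrices and the trace\<close>

lemma PSD_Sym: "X \<in> PSD \<Longrightarrow> X \<in> Sym"
  by (simp add: PSD_def)

lemma matrix_square_Sym: "X \<in> Sym \<Longrightarrow> X ** X \<in> Sym"
  by (simp add: Sym_def matrix_transpose_mul)

text \<open>In an eigenbasis of \<open>T\<close> the inner product is a sum of squared eigenvalues
  times values of the quadratic form of \<open>Z\<close>.\<close>

lemma PSD_inner_square:
  assumes "Z \<in> PSD" "T \<in> Sym"
  shows "0 \<le> Z \<bullet> (T ** T)"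
proof -
  obtain B l where "orthonormal_basis B" and T: "T = orthonormal_basis.spec_mat B l"
    using spectral_decomposition[OF assms(2)] .
  then interpret orthonormal_basis B
    by simp
  show ?thesis
    using assms(1) by (auto simp: T spec_mat_mult inner_spec_mat PSD_def intro!: sum_nonneg)
qed

text \<open>The inner product with the identity is the trace, here a sum of nonnegative
  eigenvalues.\<close>

lemma PSD_trace_0_imp_0:
  assumes "D \<in> PSD" "D \<bullet> mat 1 = 0"
  shows "D = 0"
proof -
  obtain B l where "orthonormal_basis B" and D: "D = orthonormal_basis.spec_mat B l"
    using spectral_decomposition[OF PSD_Sym[OF assms(1)]] .
  then interpret orthonormal_basis B
    by simp
  have l: "b \<bullet> (D *v b) = l b" if "b \<in> B" for b
    using that by (simp add: D spec_mat_basis inner_basis)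
  have one: "mat 1 = spec_mat (\<lambda>_. 1)"
    by (rule spec_matI) simp
  have "(\<Sum>b\<in>B. l b) = 0"
    using assms(2) l by (simp add: one inner_spec_mat)
  moreover have "l b \<ge> 0" if "b \<in> B" for b
    using assms(1) l[OF that] unfolding PSD_def by (metis (mono_tags, lifting) mem_Collect_eq)
  ultimately have "l b = 0" if "b \<in> B" for b
    using that sum_nonneg_eq_0_iff[OF finite_B] by blast
  then show ?thesis
    by (simp add: D spec_mat_def)
qed

text \<open>Both sides equal the trace of \<open>W\<close>. For a unit \<open>E\<close> of a
  subspace this makes \<open>E\<close> the projection of the identity matrix.\<close>

lemma inner_mult_unit:
  fixes W E :: "real^'n^'n"
  assumes "W \<in> Sym" "E ** W = W"
  shows "E \<bullet> W = mat 1 \<bullet> W"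
  using assms trace_inner_eq_inner[OF assms(1), of E] trace_inner_eq_inner[OF assms(1), of "mat 1"]
  by (simp add: trace_inner_def)

section \<open>Orthogonal projections, and square closure from positivity and unitality\<close>

locale sym_subspace =
  fixes S :: "(real^'n^'n) set"
  assumes subspace: "subspace S" and Sym: "S \<subseteq> Sym"
begin

text \<open>Together with the converse \<open>orth_proj_eqI\<close>, these two facts replace the
  definite description from here on.\<close>

lemma orth_proj_mem: "orth_proj S X \<in> S"
  and orth_proj_inner: "W \<in> S \<Longrightarrow> orth_proj S X \<bullet> W = X \<bullet> W"
proof -
  have *: "orth_proj S X \<in> S \<and> (\<forall>W\<in>S. trace_inner (X - orth_proj S X) W = 0)"
    unfolding orth_proj_def by (rule theI'[OF orth_proj_ex1[OF subspace Sym]])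
  then show "orth_proj S X \<in> S" ..
  show "orth_proj S X \<bullet> W = X \<bullet> W" if "W \<in> S"
  proof -
    have "trace_inner (X - orth_proj S X) W = (X - orth_proj S X) \<bullet> W"
      using that Sym by (intro trace_inner_eq_inner) auto
    then show ?thesis
      using * that by (simp add: inner_diff_left)
  qed
qed

lemma orth_proj_eqI:
  assumes "Z \<in> S" "\<And>W. W \<in> S \<Longrightarrow> Z \<bullet> W = X \<bullet> W"
  shows "orth_proj S X = Z"
proof -
  define D where "D = orth_proj S X - Z"
  have "D \<in> S"
    using assms(1) orth_proj_mem subspace by (simp add: D_def subspace_diff)
  then have "D \<bullet> D = 0"
    using assms(2)[of D] orth_proj_inner[of D X] by (simp add: D_def inner_diff_left)
  then show ?thesis
    by (simp add: D_def)
qed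

lemma orth_proj_id: "X \<in> S \<Longrightarrow> orth_proj S X = X"
  by (rule orth_proj_eqI) auto

lemma linear_orth_proj: "linear (orth_proj S)"
proof (rule linearI)
  show "orth_proj S (X + Y) = orth_proj S X + orth_proj S Y" for X Y
    using subspace by (intro orth_proj_eqI)
      (auto simp: inner_add_left orth_proj_inner orth_proj_mem subspace_add)
  show "orth_proj S (c *\<^sub>R X) = c *\<^sub>R orth_proj S X" for c X
    using subspace by (intro orth_proj_eqI)
      (auto simp: orth_proj_inner orth_proj_mem subspace_scale)
qed

text \<open>Kadison's inequality $P(X^2) \ge P(X)^2$ holds because $P$ sends the spectral projections
  of $X$ to positive semidefinite matrices; for $X \in S$ both sides have the same trace.\<close>

lemma square_closed_if_positive_unital:
  assumes pos: "orth_proj S ` PSD \<subseteq> PSD"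
    and E: "E \<in> S" "\<And>X. X \<in> S \<Longrightarrow> jordan_prod X E = X"
    and X: "X \<in> S"
  shows "X ** X \<in> S"
proof -
  let ?P = "orth_proj S"
  interpret P: linear ?P
    by (rule linear_orth_proj)
  have twice: "W ** E + E ** W = W + W" if "W \<in> S" for W
  proof -
    have "2 *\<^sub>R jordan_prod W E = 2 *\<^sub>R W"
      using E(2)[OF that] by simp
    then show ?thesis
      by (simp add: jordan_prod_def scaleR_2)
  qed
  have EE: "E ** E = E"
    using twice[OF E(1)] by (simp add: scaleR_2[symmetric])
  \<comment> \<open>Multiplying \<open>W E + E W = 2 W\<close> by the idempotent \<open>E\<close>
    from the left and from the right gives \<open>E W E = E W\<close> and
    \<open>E W E = W E\<close>. Thus \<open>E\<close> commutes with \<open>W\<close>, and the Jordan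
    unit is an ordinary unit.\<close>
  have unit: "E ** W = W" if "W \<in> S" for W
  proof -
    have "E ** (W ** E + E ** W) = E ** (W + W)" "(W ** E + E ** W) ** E = (W + W) ** E"
      using twice[OF that] by (simp_all only:)
    moreover have "E ** (E ** W) = E ** W" "(W ** E) ** E = W ** E"
      by (simp add: matrix_mul_assoc EE) (simp add: matrix_mul_assoc[symmetric] EE)
    ultimately have "E ** (W ** E) = E ** W" "(E ** W) ** E = W ** E"
      by (simp_all only: matrix_add_ldistrib matrix_add_rdistrib add_left_cancel add_right_cancel)
    then have "E ** W = W ** E"
      by (simp add: matrix_mul_assoc)
    then show ?thesis
      using twice[OF that] by (simp add: scaleR_2[symmetric])
  qed
  have E_inner: "E \<bullet> W = mat 1 \<bullet> W" if "W \<in> S" for W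
    using that Sym unit by (intro inner_mult_unit) auto
  have P1: "?P (mat 1) = E"
    using E(1) E_inner by (intro orth_proj_eqI) auto
  have XS: "X \<in> Sym"
    using X Sym by blast
  obtain B l where "orthonormal_basis B" and Xl: "X = orthonormal_basis.spec_mat B l"
    using spectral_decomposition[OF XS] .
  then interpret orthonormal_basis B
    by simp
  define A where "A b = ?P (outer b)" for b
  have A: "A b \<in> PSD" for b
    using pos outer_PSD by (auto simp: A_def)
  have P_spec: "?P (spec_mat g) *v v = (\<Sum>b\<in>B. g b *\<^sub>R (A b *v v))" for g v
    by (simp add: spec_mat_def P.sum P.scale A_def matrix_vector_mult_sum)
  have one: "mat 1 = spec_mat (\<lambda>_. 1)"
    by (rule spec_matI) simp
  \<comment> \<open>Sum the values of the positive semidefinite \<open>A b\<close> at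
    \<open>l b v - w\<close> over the eigenbasis. This is positivity of the block matrix with
    diagonal \<open>P(X^2)\<close>, \<open>P(1)\<close> and off-diagonal \<open>P(X)\<close>, tested
    at \<open>(v, -w)\<close>.\<close>
  have kadison: "0 \<le> v \<bullet> (?P (X ** X) *v v) - 2 * (w \<bullet> (?P X *v v)) + w \<bullet> (?P (mat 1) *v w)" for v w
  proof -
    have "(l b *\<^sub>R v - w) \<bullet> (A b *v (l b *\<^sub>R v - w)) =
        l b * l b * (v \<bullet> (A b *v v)) - 2 * (l b * (w \<bullet> (A b *v v))) + w \<bullet> (A b *v w)" for b
    proof -
      have "v \<bullet> (A b *v w) = w \<bullet> (A b *v v)"
        using Sym_inner[OF PSD_Sym[OF A], of b v w] by (simp add: inner_commute)
      then show ?thesis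
        by (simp add: matrix_vector_mult_diff_distrib matrix_vector_mult_scaleR inner_diff_left
            inner_diff_right algebra_simps)
    qed
    then have "0 \<le> l b * l b * (v \<bullet> (A b *v v)) - 2 * (l b * (w \<bullet> (A b *v v))) + w \<bullet> (A b *v w)" for b
      using A[of b] unfolding PSD_def by (metis (mono_tags, lifting) mem_Collect_eq)
    then have "0 \<le> (\<Sum>b\<in>B. l b * l b * (v \<bullet> (A b *v v)) - 2 * (l b * (w \<bullet> (A b *v v))) + w \<bullet> (A b *v w))"
      by (intro sum_nonneg)
    then show ?thesis
      unfolding Xl one spec_mat_mult P_spec
      by (simp add: inner_sum_right sum.distrib sum_subtractf sum_distrib_left)
  qed
  define D where "D = ?P (X ** X) - X ** X"
  \<comment> \<open>Take \<open>w = X v\<close>: since \<open>P(X) = X\<close>,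
    \<open>P(1) = E\<close> and \<open>E X = X\<close>, the last two terms of \<open>kadison\<close>
    combine to minus the squared norm of \<open>X v\<close>.\<close>
  have "0 \<le> v \<bullet> (D *v v)" for v
  proof -
    have "(X *v v) \<bullet> (E *v (X *v v)) = (X *v v) \<bullet> (X *v v)"
      using unit[OF X] by (simp add: matrix_vector_mul_assoc)
    moreover have "v \<bullet> ((X ** X) *v v) = (X *v v) \<bullet> (X *v v)"
      by (simp add: matrix_vector_mul_assoc[symmetric] Sym_inner[OF XS])
    ultimately show ?thesis
      using kadison[of v "X *v v"]
      by (simp add: D_def P1 orth_proj_id[OF X] matrix_vector_mult_diff_rdistrib inner_diff_right)
  qed
  moreover have "D \<in> Sym"
    unfolding D_def using orth_proj_mem Sym matrix_square_Sym[OF XS]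
    by (intro subspace_diff[OF Sym_subspace]) auto
  ultimately have "D \<in> PSD"
    by (simp add: PSD_def)
  \<comment> \<open>The trace of \<open>P(X^2)\<close> is its inner product with \<open>E\<close>,
    hence that of \<open>X^2\<close> with \<open>E\<close>. The latter is the trace of
    \<open>X^2\<close> because \<open>E X = X\<close> already gives \<open>E X^2 = X^2\<close>,
    before \<open>X^2\<close> is known to lie in \<open>S\<close>.\<close>
  moreover have "D \<bullet> mat 1 = 0"
  proof -
    have "E \<bullet> (X ** X) = mat 1 \<bullet> (X ** X)"
      using unit[OF X] by (intro inner_mult_unit matrix_square_Sym XS) (simp add: matrix_mul_assoc)
    moreover have "mat 1 \<bullet> ?P (X ** X) = E \<bullet> (X ** X)"
      using E_inner[OF orth_proj_mem] orth_proj_inner[OF E(1)] by (simp add: inner_commute)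
    ultimately show ?thesis
      by (simp add: D_def inner_diff_right inner_commute[of _ "mat 1"])
  qed
  ultimately have "D = 0"
    by (rule PSD_trace_0_imp_0)
  then show ?thesis
    using orth_proj_mem[of "X ** X"] by (simp add: D_def)
qed

end

section \<open>Functional calculus, positivity and units in square-closed subspaces\<close>

locale jordan_subalgebra = sym_subspace +
  assumes square: "X \<in> S \<Longrightarrow> X ** X \<in> S"
begin

text \<open>Polarization of the square.\<close>

lemma anticommutator:
  assumes "X \<in> S" "Y \<in> S"
  shows "X ** Y + Y ** X \<in> S"
proof -
  have "X ** Y + Y ** X = (X + Y) ** (X + Y) - X ** X - Y ** Y"
    by (simp add: matrix_add_ldistrib matrix_add_rdistrib)
  then show ?thesis
    using assms square subspace by (simp add: subspace_add subspace_diff)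
qed

text \<open>By Lagrange interpolation \<^term>\<open>f\<close> agrees on the spectrum with a polynomial
  without constant term.\<close>

lemma functional_calculus:
  fixes f :: "real \<Rightarrow> real"
  assumes "orthonormal_basis B" and mem: "orthonormal_basis.spec_mat B l \<in> S" and "f 0 = 0"
  shows "orthonormal_basis.spec_mat B (\<lambda>b. f (l b)) \<in> S"
proof -
  interpret orthonormal_basis B
    by fact
  \<comment> \<open>Matrices diagonal in the same basis commute, so their product is half their
    anticommutator.\<close>
  have times: "spec_mat (\<lambda>b. g b * h b) \<in> S" if "spec_mat g \<in> S" "spec_mat h \<in> S" for g h
  proof -
    have "spec_mat (\<lambda>b. g b * h b) = (1/2) *\<^sub>R (spec_mat g ** spec_mat h + spec_mat h ** spec_mat g)"
      by (simp add: spec_mat_mult spec_mat_add spec_mat_scale mult.commute)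
    then show ?thesis
      using anticommutator[OF that] subspace by (simp add: subspace_scale)
  qed
  \<comment> \<open>The leading factor \<open>l b\<close> keeps the polynomial free of a constant
    term, which would require the identity matrix in \<open>S\<close>.\<close>
  have prod: "spec_mat (\<lambda>b. l b * (\<Prod>\<mu>\<in>M. l b - \<mu>)) \<in> S" if "finite M" for M
    using that
  proof (induction M)
    case (insert \<nu> M)
    let ?g = "\<lambda>b. l b * (\<Prod>\<mu>\<in>M. l b - \<mu>)"
    have "spec_mat (\<lambda>b. l b * (\<Prod>\<mu>\<in>insert \<nu> M. l b - \<mu>)) =
        spec_mat (\<lambda>b. l b * ?g b) - \<nu> *\<^sub>R spec_mat ?g"
      using insert.hyps by (simp add: spec_mat_diff spec_mat_scale algebra_simps)
    then show ?case
      using times[OF mem insert.IH] insert.IH subspace by (simp add: subspace_diff subspace_scale)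
  qed (simp add: mem)
  let ?N = "l ` B - {0}"
  \<comment> \<open>An unnormalized Lagrange polynomial with an extra factor \<open>x\<close>: it
    vanishes at 0 and at every eigenvalue other than \<open>\<kappa>\<close>, but not at a nonzero
    \<open>\<kappa>\<close>. The node 0 is left out of \<open>?N\<close>; there
    \<open>f 0 = 0\<close> matches the vanishing sum.\<close>
  define h where "h \<kappa> x = x * (\<Prod>\<mu>\<in>l ` B - {\<kappa>}. x - \<mu>)" for \<kappa> x :: real
  have fin: "finite (l ` B)"
    using finite_B by simp
  have "(\<Sum>\<kappa>\<in>?N. f \<kappa> / h \<kappa> \<kappa> * h \<kappa> (l b)) = f (l b)" if "b \<in> B" for b
  proof -
    have h_off: "h \<kappa> (l b) = 0" if "\<kappa> \<noteq> l b" for \<kappa>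
      using that \<open>b \<in> B\<close> fin by (auto simp: h_def)
    show ?thesis
    proof (cases "l b = 0")
      case True
      then show ?thesis
        by (simp add: h_def assms(3))
    next
      case False
      then have "(\<Sum>\<kappa>\<in>?N. f \<kappa> / h \<kappa> \<kappa> * h \<kappa> (l b)) = f (l b) / h (l b) (l b) * h (l b) (l b)"
        using that fin h_off by (subst sum.remove[of _ "l b"]) (auto intro!: sum.neutral)
      moreover have "h (l b) (l b) \<noteq> 0"
        using False fin by (simp add: h_def)
      ultimately show ?thesis
        by simp
    qed
  qed
  then have "spec_mat (\<lambda>b. f (l b)) = spec_mat (\<lambda>b. \<Sum>\<kappa>\<in>?N. f \<kappa> / h \<kappa> \<kappa> * h \<kappa> (l b))"
    by (intro spec_mat_cong) simp
  also have "\<dots> = (\<Sum>\<kappa>\<in>?N. (f \<kappa> / h \<kappa> \<kappa>) *\<^sub>R spec_mat (\<lambda>b. h \<kappa> (l b)))"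
    unfolding spec_mat_def scaleR_sum_left scaleR_sum_right scaleR_scaleR by (rule sum.swap)
  also have "\<dots> \<in> S"
    using prod fin subspace unfolding h_def by (intro subspace_sum subspace_scale) auto
  finally show ?thesis .
qed

lemma orth_proj_PSD:
  assumes "Z \<in> PSD"
  shows "orth_proj S Z \<in> PSD"
proof -
  define W where "W = orth_proj S Z"
  have W: "W \<in> S" "W \<in> Sym"
    using orth_proj_mem Sym by (auto simp: W_def)
  obtain B l where B: "orthonormal_basis B" and Wl: "W = orthonormal_basis.spec_mat B l"
    using spectral_decomposition[OF W(2)] .
  then interpret orthonormal_basis B
    by simp
  \<comment> \<open>\<open>T\<close> is the negative part of \<open>W\<close>. It lies in
    \<open>S\<close> because \<open>f 0 = 0\<close>, and so does its square.\<close>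
  define f where "f x = max 0 (- x)" for x :: real
  define T where "T = spec_mat (\<lambda>b. f (l b))"
  have T: "T \<in> S"
    using functional_calculus[OF B, of l f] W(1) by (simp add: T_def Wl f_def)
  have "0 \<le> Z \<bullet> (T ** T)"
    using assms T Sym by (intro PSD_inner_square) auto
  also have "\<dots> = W \<bullet> (T ** T)"
    using orth_proj_inner[OF square[OF T], of Z] by (simp add: W_def)
  also have "\<dots> = (\<Sum>b\<in>B. f (l b) * f (l b) * l b)"
    by (simp add: T_def spec_mat_mult inner_spec_mat Wl spec_mat_basis inner_basis)
  finally have "(\<Sum>b\<in>B. - (f (l b) * f (l b) * l b)) \<le> 0"
    by (simp add: sum_negf)
  \<comment> \<open>\<open>f\<close> vanishes at nonnegative eigenvalues, so only negative ones
    contribute; nonnegative terms with a nonpositive sum must all be 0.\<close>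
  moreover have nonneg: "0 \<le> - (f (l b) * f (l b) * l b)" for b
    by (cases "l b \<ge> 0") (simp_all add: f_def max_def mult_nonneg_nonpos)
  ultimately have "(\<Sum>b\<in>B. - (f (l b) * f (l b) * l b)) = 0"
    by (intro antisym sum_nonneg)
  then have "\<forall>b\<in>B. - (f (l b) * f (l b) * l b) = 0"
    by (subst (asm) sum_nonneg_eq_0_iff[OF finite_B nonneg])
  then have "l b \<ge> 0" if "b \<in> B" for b
    using that by (fastforce simp: f_def max_def split: if_splits)
  then show ?thesis
    using spec_mat_PSD[of l] by (simp add: W_def[symmetric] Wl)
qed

text \<open>The unit is the support projection of the sum of the squares of a basis.\<close>

lemma unit_exists: "\<exists>E\<in>S. \<forall>X\<in>S. jordan_prod X E = X"
proof -
  obtain G where G: "G \<subseteq> S" "finite G" "span G = S"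
    using basis_subspace_exists[OF subspace] by metis
  define W where "W = (\<Sum>A\<in>G. A ** A)"
  have "W \<in> S"
    unfolding W_def using G(1) square by (intro subspace_sum[OF subspace]) auto
  then have W: "W \<in> S" "W \<in> Sym"
    using Sym by auto
  obtain B l where B: "orthonormal_basis B" and Wl: "W = orthonormal_basis.spec_mat B l"
    using spectral_decomposition[OF W(2)] .
  then interpret orthonormal_basis B
    by simp
  \<comment> \<open>With this indicator, \<open>E\<close> projects onto the range of
    \<open>W\<close>.\<close>
  define f where "f x = (if x = 0 then 0 else 1 :: real)" for x :: real
  define E where "E = spec_mat (\<lambda>b. f (l b))"
  have E: "E \<in> S"
    using functional_calculus[OF B, of l f] W(1) by (simp add: E_def Wl f_def)
  have WE: "W ** E = W"
    unfolding Wl E_def spec_mat_mult by (rule spec_mat_cong) (simp add: f_def)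
  have "A ** E = A" if "A \<in> G" for A
  proof -
    \<comment> \<open>The vector \<open>v - E v\<close> is in the kernel of \<open>W\<close>. Since
      \<open>w \<bullet> W w\<close> is the sum of the squared norms of \<open>A w\<close>, that
      kernel is contained in the kernel of every \<open>A\<close> in \<open>G\<close>.\<close>
    have "A *v (v - E *v v) = 0" for v
    proof -
      define w where "w = v - E *v v"
      have "W *v w = 0"
        by (simp add: w_def matrix_vector_mult_diff_distrib matrix_vector_mul_assoc WE)
      moreover have "w \<bullet> (W *v w) = (\<Sum>A\<in>G. (A *v w) \<bullet> (A *v w))"
      proof -
        have "w \<bullet> (W *v w) = (\<Sum>A\<in>G. w \<bullet> (A *v (A *v w)))"
          using matrix_vector_mult_sum[of "\<lambda>_. 1" "\<lambda>A. A ** A" G w]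
          by (simp add: W_def inner_sum_right matrix_vector_mul_assoc)
        also have "\<dots> = (\<Sum>A\<in>G. (A *v w) \<bullet> (A *v w))"
          using G(1) Sym by (intro sum.cong refl Sym_inner[symmetric]) auto
        finally show ?thesis .
      qed
      ultimately have "(\<Sum>A\<in>G. (A *v w) \<bullet> (A *v w)) = 0"
        by simp
      then have "(A *v w) \<bullet> (A *v w) = 0"
        using that sum_nonneg_eq_0_iff[OF G(2), of "\<lambda>A. (A *v w) \<bullet> (A *v w)"] by simp
      then show ?thesis
        by (simp add: w_def)
    qed
    then show ?thesis
      by (simp add: matrix_eq matrix_vector_mult_diff_distrib matrix_vector_mul_assoc)
  qed
  moreover have "subspace {X. X ** E = X}"
    by (auto simp: subspace_def matrix_add_rdistrib scaleR_matrix_mult)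
  ultimately have "span G \<subseteq> {X. X ** E = X}"
    by (intro span_minimal) auto
  then have XE: "X ** E = X" if "X \<in> S" for X
    using that G(3) by blast
  have "E ** X = X" if "X \<in> S" for X
  proof -
    have "transpose (X ** E) = transpose X"
      using XE[OF that] by simp
    moreover have "transpose X = X" "transpose E = E"
      using that E Sym by (auto simp: Sym_def)
    ultimately show ?thesis
      by (simp add: matrix_transpose_mul)
  qed
  then show ?thesis
    using XE E by (intro bexI[of _ E]) (auto simp: jordan_prod_def scaleR_2[symmetric])
qed

end

section \<open>Orthogonal complements and commuting projections\<close>

lemma sym_subspace_perp: "sym_subspace (perp L)"
proof
  show "perp L \<subseteq> Sym"
    by (auto simp: perp_def)
  then show "subspace (perp L)"
    using Sym_subspace
    by (auto simp: subspace_def perp_def trace_inner_def scaleR_matrix_mult matrix_add_rdistrib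
        trace_def sum.distrib sum_distrib_left[symmetric])
qed

context sym_subspace
begin

lemma perp_iff: "X \<in> perp S \<longleftrightarrow> X \<in> Sym \<and> (\<forall>Z\<in>S. X \<bullet> Z = 0)"
  using Sym by (auto simp: perp_def trace_inner_eq_inner subset_iff)

lemma perp_inner: "X \<in> perp S \<Longrightarrow> Z \<in> S \<Longrightarrow> X \<bullet> Z = 0" "X \<in> perp S \<Longrightarrow> Z \<in> S \<Longrightarrow> Z \<bullet> X = 0"
  by (simp_all add: perp_iff inner_commute[of Z])

lemma perp_inter: "X \<in> S \<Longrightarrow> X \<in> perp S \<Longrightarrow> X = 0"
  by (auto simp: perp_iff)

text \<open>Symmetry of \<open>X\<close> matters: complements are taken inside \<open>Sym\<close>,
  so the difference lies in \<open>perp S\<close> only for symmetric \<open>X\<close>.\<close>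

lemma orth_proj_perp:
  assumes "X \<in> Sym"
  shows "orth_proj (perp S) X = X - orth_proj S X"
proof -
  interpret perp: sym_subspace "perp S"
    by (rule sym_subspace_perp)
  show ?thesis
  proof (rule perp.orth_proj_eqI)
    show "X - orth_proj S X \<in> perp S"
      using assms Sym orth_proj_mem Sym_subspace
      by (auto simp: perp_iff inner_diff_left orth_proj_inner intro!: subspace_diff)
    show "(X - orth_proj S X) \<bullet> W = X \<bullet> W" if "W \<in> perp S" for W
      using that orth_proj_mem by (simp add: perp_inner inner_diff_left)
  qed
qed

text \<open>Allows the roles of \<open>L\<close> and \<open>perp L\<close>, and thereby of the
  primal and the dual problem, to be exchanged.\<close>

lemma perp_perp: "perp (perp S) = S"
proof -
  interpret perp: sym_subspace "perp S"
    by (rule sym_subspace_perp)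
  show ?thesis
  proof
    show "S \<subseteq> perp (perp S)"
      using Sym by (auto simp: perp.perp_iff perp_inner)
    show "perp (perp S) \<subseteq> S"
    proof
      fix X assume X: "X \<in> perp (perp S)"
      then have "X \<in> Sym"
        by (simp add: perp.perp_iff)
      define D where "D = X - orth_proj S X"
      have D: "D \<in> perp S"
        using orth_proj_perp[OF \<open>X \<in> Sym\<close>] perp.orth_proj_mem[of X] by (simp add: D_def)
      have "X \<bullet> D = 0" "orth_proj S X \<bullet> D = 0"
        using X D orth_proj_mem by (simp_all add: perp.perp_inner perp_inner)
      then have "D \<bullet> D = 0"
        by (simp add: D_def inner_diff_left)
      then show "X \<in> S"
        using orth_proj_mem[of X] by (simp add: D_def)
    qed
  qed
qed

end

text \<open>Instantiated with \<open>L\<close> for the primal datum \<open>Y\<close> and with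
  \<open>perp L\<close> for the dual datum \<open>C\<close>.\<close>

locale two_sym_subspaces = S: sym_subspace S + L: sym_subspace L
  for S L :: "(real^'n^'n) set"
begin

sublocale perp: sym_subspace "perp L"
  by (rule sym_subspace_perp)

sublocale P: linear "orth_proj S"
  by (rule S.linear_orth_proj)

lemma perp_invariant:
  assumes "orth_proj L ` S \<subseteq> S"
  shows "orth_proj (perp L) ` S \<subseteq> S"
  using assms S.Sym S.subspace by (auto simp: L.orth_proj_perp subset_iff intro!: subspace_diff)

text \<open>The component \<open>D\<close> of \<open>orth_proj S X\<close> orthogonal to
  \<open>L\<close> stays in \<open>S\<close> by invariance. Its squared norm is therefore
  \<open>X \<bullet> D\<close>, which is 0 for \<open>X\<close> in \<open>L\<close>.\<close>

lemma invariant_swap: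
  assumes "orth_proj L ` S \<subseteq> S" "X \<in> L"
  shows "orth_proj S X \<in> L"
proof -
  let ?s = "orth_proj S X"
  define D where "D = orth_proj (perp L) ?s"
  have s: "?s \<in> S" "?s \<in> Sym"
    using S.orth_proj_mem S.Sym by auto
  then have D: "D \<in> S" "D \<in> perp L"
    using perp_invariant[OF assms(1)] perp.orth_proj_mem by (auto simp: D_def)
  have "D \<bullet> D = ?s \<bullet> D"
    using D(2) by (simp add: D_def perp.orth_proj_inner)
  also have "\<dots> = X \<bullet> D"
    using D(1) by (rule S.orth_proj_inner)
  also have "\<dots> = 0"
    using D(2) assms(2) by (rule L.perp_inner)
  finally have "?s = orth_proj L ?s"
    using L.orth_proj_perp[OF s(2)] by (simp add: D_def)
  then show ?thesis
    using L.orth_proj_mem by metis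
qed

text \<open>The affine space is also \<open>L\<close> translated by the component of
  \<open>Y\<close> in \<open>perp L\<close>; this anchor is fixed by the projection onto
  \<open>S\<close>.\<close>

lemma affine_invariant:
  assumes "Y \<in> Sym" "orth_proj (perp L) Y \<in> S" "\<And>X. X \<in> L \<Longrightarrow> orth_proj S X \<in> L"
  shows "orth_proj S ` ((+) Y ` L) \<subseteq> (+) Y ` L"
proof -
  have "orth_proj S (Y + X) \<in> (+) Y ` L" if "X \<in> L" for X
  proof -
    let ?Y = "orth_proj L Y"
    have "orth_proj S (Y + X) = orth_proj S (orth_proj (perp L) Y + (?Y + X))"
      by (simp add: L.orth_proj_perp[OF assms(1)])
    also have "\<dots> = orth_proj (perp L) Y + orth_proj S (?Y + X)"
      by (simp only: P.add S.orth_proj_id[OF assms(2)])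
    also have "\<dots> = Y + (orth_proj S (?Y + X) - ?Y)"
      by (simp add: L.orth_proj_perp[OF assms(1)])
    finally show ?thesis
      using that assms(3) L.orth_proj_mem L.subspace
      by (auto intro!: imageI subspace_diff subspace_add simp del: P.add)
  qed
  then show ?thesis
    by blast
qed

text \<open>For the linear statement, subtract the images of \<open>Y + X\<close> and
  \<open>Y + 0\<close> to cancel the translation.\<close>

lemma affine_invariant_dest:
  assumes "orth_proj S ` ((+) Y ` L) \<subseteq> (+) Y ` L"
  shows "X \<in> L \<Longrightarrow> orth_proj S (Y + X) - Y \<in> L" "X \<in> L \<Longrightarrow> orth_proj S X \<in> L"
proof -
  show *: "orth_proj S (Y + X) - Y \<in> L" if "X \<in> L" for X
  proof -
    have "orth_proj S (Y + X) \<in> (+) Y ` L"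
      using assms that by blast
    then show ?thesis
      by auto
  qed
  show "orth_proj S X \<in> L" if "X \<in> L"
  proof -
    have "orth_proj S X = (orth_proj S (Y + X) - Y) - (orth_proj S (Y + 0) - Y)"
      by (simp add: P.add)
    also have "\<dots> \<in> L"
      using L.subspace that by (intro subspace_diff *) (simp_all add: subspace_0)
    finally show ?thesis .
  qed
qed

text \<open>The anchor \<open>?p\<close> is the point of \<open>Y + L\<close> in
  \<open>perp L\<close>. Its displacement under the projection onto \<open>S\<close> lies in
  \<open>L\<close> by affine invariance and in \<open>perp L\<close> by the last assumption, so it
  is 0.\<close>

lemma anchor_mem:
  assumes "Y \<in> Sym" "orth_proj S ` ((+) Y ` L) \<subseteq> (+) Y ` L"
    and "\<And>X. X \<in> perp L \<Longrightarrow> orth_proj S X \<in> perp L"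
  shows "orth_proj (perp L) Y \<in> S"
proof -
  let ?p = "orth_proj (perp L) Y"
  have Y: "?p = Y + - orth_proj L Y"
    by (simp add: L.orth_proj_perp[OF assms(1)])
  have mL: "- orth_proj L Y \<in> L"
    using L.subspace L.orth_proj_mem by (simp add: subspace_neg)
  have "orth_proj S ?p - ?p = (orth_proj S (Y + - orth_proj L Y) - Y) - (- orth_proj L Y)"
    unfolding Y by simp
  also have "\<dots> \<in> L"
    using L.subspace affine_invariant_dest(1)[OF assms(2) mL] mL by (rule subspace_diff)
  finally have "orth_proj S ?p - ?p \<in> L" .
  moreover have "orth_proj S ?p - ?p \<in> perp L"
    using perp.subspace assms(3) perp.orth_proj_mem by (simp add: subspace_diff)
  ultimately have "orth_proj S ?p = ?p"
    using L.perp_inter by fastforce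
  then show ?thesis
    using S.orth_proj_mem by metis
qed

text \<open>Split \<open>X\<close> in \<open>S\<close> into components \<open>?a\<close> in
  \<open>L\<close> and \<open>?b\<close> in \<open>perp L\<close>. As \<open>X\<close> is fixed by
  the projection onto \<open>S\<close>, the displacements of \<open>?a\<close> and \<open>?b\<close>
  cancel; lying in complementary spaces, both are 0.\<close>

lemma invariant_swap_conv:
  assumes "\<And>X. X \<in> L \<Longrightarrow> orth_proj S X \<in> L" "\<And>X. X \<in> perp L \<Longrightarrow> orth_proj S X \<in> perp L"
  shows "orth_proj L ` S \<subseteq> S"
proof -
  have "orth_proj L X \<in> S" if "X \<in> S" for X
  proof -
    let ?a = "orth_proj L X" and ?b = "orth_proj (perp L) X"
    have "X \<in> Sym"
      using that S.Sym by blast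
    then have X: "X = ?a + ?b"
      by (simp add: L.orth_proj_perp)
    have "orth_proj S ?a + orth_proj S ?b = ?a + ?b"
      using S.orth_proj_id[OF that] X by (metis P.add)
    then have "orth_proj S ?a - ?a = ?b - orth_proj S ?b"
      by (simp add: algebra_simps)
    moreover have "orth_proj S ?a - ?a \<in> L"
      using L.subspace assms(1) L.orth_proj_mem by (simp add: subspace_diff)
    moreover have "?b - orth_proj S ?b \<in> perp L"
      using perp.subspace assms(2) perp.orth_proj_mem by (simp add: subspace_diff)
    ultimately have "orth_proj S ?a - ?a = 0"
      using L.perp_inter by metis
    then have "?a = orth_proj S ?a"
      by simp
    then show ?thesis
      using S.orth_proj_mem by metis
  qed
  then show ?thesis
    by blast
qed

end

section \<open>Algebraic characterization of admissibility\<close>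

text \<open>Admissibility as the algorithm sees it: the generators belong to \<open>S\<close>, and
  neither update enlarges it.\<close>

definition closed_subalgebra ::
  "(real^'n^'n) set \<Rightarrow> real^'n^'n \<Rightarrow> real^'n^'n \<Rightarrow> (real^'n^'n) set \<Rightarrow> bool" where
  "closed_subalgebra L C Y S \<longleftrightarrow>
     jordan_subalgebra S \<and> orth_proj L ` S \<subseteq> S \<and> orth_proj L C \<in> S \<and> orth_proj (perp L) Y \<in> S"

lemma admissible_iff_closed_subalgebra:
  assumes "sym_subspace L" "C \<in> Sym" "Y \<in> Sym"
  shows "admissible L C Y S \<longleftrightarrow> closed_subalgebra L C Y S"
proof -
  interpret L: sym_subspace L
    by fact
  show ?thesis
  proof
    assume adm: "admissible L C Y S"
    then interpret S: sym_subspace S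
      by unfold_locales (auto simp: admissible_def)
    interpret SL: two_sym_subspaces S L
      by unfold_locales
    interpret SM: two_sym_subspaces S "perp L"
      by unfold_locales
    obtain E where pos: "orth_proj S ` PSD \<subseteq> PSD" and E: "E \<in> S" "\<And>X. X \<in> S \<Longrightarrow> jordan_prod X E = X"
      and Y: "orth_proj S ` ((+) Y ` L) \<subseteq> (+) Y ` L"
      and C: "orth_proj S ` ((+) C ` perp L) \<subseteq> (+) C ` perp L"
      using adm by (auto simp: admissible_def)
    have "jordan_subalgebra S"
      using S.square_closed_if_positive_unital[OF pos E] by unfold_locales
    moreover have "orth_proj L ` S \<subseteq> S"
      using SL.affine_invariant_dest(2)[OF Y] SM.affine_invariant_dest(2)[OF C]
      by (rule SL.invariant_swap_conv)
    moreover have "orth_proj (perp L) Y \<in> S"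
      using assms(3) Y SM.affine_invariant_dest(2)[OF C] by (rule SL.anchor_mem)
    \<comment> \<open>The anchor for \<open>C\<close> and \<open>perp L\<close> is the projection
      onto \<open>perp (perp L)\<close>, which is \<open>L\<close>.\<close>
    moreover have "orth_proj L C \<in> S"
      using SM.anchor_mem[OF assms(2) C] SL.affine_invariant_dest(2)[OF Y]
      by (simp add: L.perp_perp)
    ultimately show "closed_subalgebra L C Y S"
      by (simp add: closed_subalgebra_def)
  next
    assume closed: "closed_subalgebra L C Y S"
    then interpret S: jordan_subalgebra S
      by (simp add: closed_subalgebra_def)
    interpret SL: two_sym_subspaces S L
      by unfold_locales
    interpret SM: two_sym_subspaces S "perp L"
      by unfold_locales
    have inv: "orth_proj L ` S \<subseteq> S"
      using closed by (simp add: closed_subalgebra_def)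
    have "orth_proj S ` ((+) Y ` L) \<subseteq> (+) Y ` L"
      using closed assms(3) SL.invariant_swap[OF inv]
      by (intro SL.affine_invariant) (auto simp: closed_subalgebra_def)
    moreover have "orth_proj S ` ((+) C ` perp L) \<subseteq> (+) C ` perp L"
      using closed assms(2) SM.invariant_swap[OF SL.perp_invariant[OF inv]]
      by (intro SM.affine_invariant) (auto simp: closed_subalgebra_def L.perp_perp)
    ultimately show "admissible L C Y S"
      using S.subspace S.Sym S.orth_proj_PSD S.unit_exists by (auto simp: admissible_def)
  qed
qed

section \<open>Rounds of the algorithm\<close>

lemma set_plus_superset:
  assumes "subspace S" "subspace T"
  shows "S \<subseteq> S + T" "T \<subseteq> S + T"
  using set_zero_plus2[of S T] set_zero_plus2[of T S] assms by (simp_all add: subspace_0 add.commute)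

lemma set_plus_least:
  assumes "subspace R" "S \<subseteq> R" "T \<subseteq> R"
  shows "S + T \<subseteq> R"
  using assms by (auto simp: set_plus_def subspace_add subset_iff)

lemma sym_subspace_plus:
  assumes "sym_subspace S" "sym_subspace T"
  shows "sym_subspace (S + T)"
proof -
  interpret S: sym_subspace S by fact
  interpret T: sym_subspace T by fact
  have "S + T = {x + y | x y. x \<in> S \<and> y \<in> T}"
    by (auto simp: set_plus_def)
  then show ?thesis
    using subspace_sums[OF S.subspace T.subspace] set_plus_least[OF Sym_subspace S.Sym T.Sym]
    by unfold_locales auto
qed

context sym_subspace
begin

lemma sym_subspace_image: "sym_subspace T \<Longrightarrow> sym_subspace (orth_proj S ` T)"
  using linear_orth_proj orth_proj_mem Sym
  by (auto simp: sym_subspace_def intro: linear_subspace_image)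

lemma sym_subspace_squares: "sym_subspace (span {X ** X | X. X \<in> S})"
  using Sym matrix_square_Sym
  by unfold_locales (simp, rule span_minimal[OF _ Sym_subspace], auto)

lemma square_update_sym_subspace: "sym_subspace (square_update S)"
  unfolding square_update_def
  by (intro sym_subspace_plus sym_subspace_squares) unfold_locales

lemma square_update_superset:
  "S \<subseteq> square_update S" "X \<in> S \<Longrightarrow> X ** X \<in> square_update S"
proof -
  interpret Q: sym_subspace "span {X ** X | X. X \<in> S}"
    by (rule sym_subspace_squares)
  note * = set_plus_superset[OF subspace Q.subspace]
  show "S \<subseteq> square_update S"
    unfolding square_update_def by (rule *)
  show "X ** X \<in> square_update S" if "X \<in> S"
    unfolding square_update_def using that by (intro subsetD[OF *(2)] span_base) auto
qed

lemma proj_update_sym_subspace: "sym_subspace T \<Longrightarrow> sym_subspace (proj_update S T)"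
  unfolding proj_update_def by (intro sym_subspace_plus sym_subspace_image)

lemma proj_update_superset:
  assumes "sym_subspace T"
  shows "T \<subseteq> proj_update S T" "orth_proj S ` T \<subseteq> proj_update S T"
  unfolding proj_update_def using assms sym_subspace_image[OF assms]
  by (intro set_plus_superset; simp add: sym_subspace_def)+

lemma alg_round_sym_subspace: "sym_subspace T \<Longrightarrow> sym_subspace (alg_round S T)"
  unfolding alg_round_def
  by (intro sym_subspace.square_update_sym_subspace proj_update_sym_subspace)

lemma alg_round_superset:
  assumes "sym_subspace T"
  shows "T \<subseteq> alg_round S T"
  unfolding alg_round_def using proj_update_superset(1)[OF assms]
    sym_subspace.square_update_superset(1)[OF proj_update_sym_subspace[OF assms]] by blast

text \<open>Yields minimality: by induction, no iterate leaves a closed subalgebra containing the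
  generators.\<close>

lemma alg_round_least:
  assumes "closed_subalgebra S C Y R" "T \<subseteq> R"
  shows "alg_round S T \<subseteq> R"
proof -
  interpret R: jordan_subalgebra R
    using assms(1) by (simp add: closed_subalgebra_def)
  have "proj_update S T \<subseteq> R"
    unfolding proj_update_def using assms R.subspace
    by (intro set_plus_least) (auto simp: closed_subalgebra_def)
  then show ?thesis
    unfolding alg_round_def square_update_def using R.subspace R.square
    by (intro set_plus_least span_minimal) auto
qed

text \<open>Both half-updates only enlarge, so a round that adds nothing consists of two
  half-updates that add nothing.\<close>

lemma alg_round_fixpoint:
  assumes "sym_subspace T" "alg_round S T = T"
  shows "jordan_subalgebra T" "orth_proj S ` T \<subseteq> T"
proof -
  interpret T: sym_subspace T by fact
  interpret U: sym_subspace "proj_update S T"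
    using assms(1) by (rule proj_update_sym_subspace)
  have "proj_update S T \<subseteq> T"
    using U.square_update_superset(1) assms(2) by (simp add: alg_round_def)
  then have eq: "proj_update S T = T"
    using proj_update_superset(1)[OF assms(1)] by blast
  then show "orth_proj S ` T \<subseteq> T"
    using proj_update_superset(2)[OF assms(1)] by simp
  show "jordan_subalgebra T"
    using T.square_update_superset(2) assms(2) eq by unfold_locales (simp add: alg_round_def)
qed

end

section \<open>Stabilization of the chain and its limit\<close>

text \<open>Otherwise the dimension grows by at least 1 at each step and exceeds that of the whole
  space at index \<open>Suc DIM('a)\<close>.\<close>

lemma ascending_subspaces_stabilize:
  fixes U :: "nat \<Rightarrow> 'a::euclidean_space set"
  assumes "\<And>k. subspace (U k)" "\<And>k. U k \<subseteq> U (Suc k)"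
  shows "\<exists>k. U (Suc k) = U k"
proof (rule ccontr)
  assume "\<nexists>k. U (Suc k) = U k"
  then have "dim (U k) < dim (U (Suc k))" for k
    using assms by (intro dim_psubset) (auto simp: span_eq_iff[THEN iffD2])
  then have "strict_mono (\<lambda>k. dim (U k))"
    by (simp add: strict_mono_Suc_iff)
  then have "Suc DIM('a) \<le> dim (U (Suc DIM('a)))"
    by (rule strict_mono_imp_increasing)
  then show False
    using dim_subset_UNIV[of "U (Suc DIM('a))"] by simp
qed

theorem theorem3p2:
  fixes L :: "(real^'n^'n) set" and C Y :: "real^'n^'n"
  assumes "subspace L" and "L \<subseteq> Sym" and "C \<in> Sym" and "Y \<in> Sym"
  shows "(\<forall>k. subspace ((alg_round L ^^ k) (alg_init L C Y)) \<and>
              (alg_round L ^^ k) (alg_init L C Y) \<subseteq> (alg_round L ^^ Suc k) (alg_init L C Y)) \<and>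
         (\<exists>K. \<forall>k\<ge>K. (alg_round L ^^ k) (alg_init L C Y) = S_opt L C Y) \<and>
         while_option (\<lambda>S. alg_round L S \<noteq> S) (alg_round L) (alg_init L C Y) = Some (S_opt L C Y)"
proof -
  interpret L: sym_subspace L
    using assms(1,2) by unfold_locales
  interpret perp: sym_subspace "perp L"
    by (rule sym_subspace_perp)
  define U where "U k = (alg_round L ^^ k) (alg_init L C Y)" for k
  have U_Suc: "U (Suc k) = alg_round L (U k)" for k
    by (simp add: U_def)
  have U0: "U 0 = span {orth_proj L C, orth_proj (perp L) Y}"
    by (simp add: U_def alg_init_def)
  have U_sym: "sym_subspace (U k)" for k
  proof (induction k)
    case 0
    have "orth_proj L C \<in> Sym" "orth_proj (perp L) Y \<in> Sym"
      using L.orth_proj_mem L.Sym perp.orth_proj_mem perp.Sym by auto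
    then show ?case
      unfolding U0 by unfold_locales (simp_all add: span_minimal Sym_subspace)
  qed (simp add: U_Suc L.alg_round_sym_subspace)
  have mono: "U k \<subseteq> U (Suc k)" for k
    unfolding U_Suc using U_sym by (rule L.alg_round_superset)
  have U_least: "U k \<subseteq> S" if "closed_subalgebra L C Y S" for k S
  proof (induction k)
    case 0
    have "subspace S"
      using that by (simp add: closed_subalgebra_def jordan_subalgebra_def sym_subspace_def)
    then show ?case
      unfolding U0 using that by (intro span_minimal) (auto simp: closed_subalgebra_def)
  qed (simp add: U_Suc L.alg_round_least[OF that])
  have S_opt_eq: "S_opt L C Y = \<Inter> {S. closed_subalgebra L C Y S}"
    using admissible_iff_closed_subalgebra[OF L.sym_subspace_axioms assms(3,4)]
    by (simp add: S_opt_def)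
  \<comment> \<open>A stable iterate is a closed subalgebra and lies inside all others, so it is
    their intersection. The claim is needed for every stable index, since the loop may stop before
    \<open>K\<close>.\<close>
  have fixpoint: "U k = S_opt L C Y" if "alg_round L (U k) = U k" for k
  proof -
    have "U 0 \<subseteq> U k"
      using lift_Suc_mono_le[of U 0 k] mono by simp
    then have "orth_proj L C \<in> U k" "orth_proj (perp L) Y \<in> U k"
      unfolding U0 by (auto intro: span_base)
    then have "closed_subalgebra L C Y (U k)"
      using L.alg_round_fixpoint[OF U_sym that] by (simp add: closed_subalgebra_def)
    then show ?thesis
      unfolding S_opt_eq using U_least by blast
  qed
  have sub: "subspace (U k)" for k
    using U_sym by (simp add: sym_subspace_def)
  obtain K where K: "alg_round L (U K) = U K"
    using ascending_subspaces_stabilize[of U, OF sub mono] by (auto simp: U_Suc)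
  have "U k = U K" if "K \<le> k" for k
    using that by (induction k rule: dec_induct) (simp_all add: U_Suc K)
  then have stable: "\<forall>k\<ge>K. U k = S_opt L C Y"
    using fixpoint[OF K] by simp
  \<comment> \<open>The first stable index, with the negated loop condition in the form in which
    \<open>while_option_def\<close> uses it.\<close>
  define k0 where "k0 = (LEAST k. \<not> alg_round L (U k) \<noteq> U k)"
  have "alg_round L (U k0) = U k0"
    using LeastI[of "\<lambda>k. \<not> alg_round L (U k) \<noteq> U k" K] K by (simp add: k0_def)
  then have "while_option (\<lambda>S. alg_round L S \<noteq> S) (alg_round L) (alg_init L C Y) = Some (S_opt L C Y)"
    using K fixpoint[of k0] by (auto simp: while_option_def k0_def U_def)
  then show ?thesis
    using sub mono stable unfolding U_def by blast
qed

end
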